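(* Let $X$ be a real normed space, let $\mathcal F$ be a directionally fine family of closed cones in $X$, let $K\subset X$ be a closed cone, and let $A\subset X\setminus\{0_X\}$ be directionally compact with $A\cap K=\varnothing$. Then there exist finitely many cones $C_i\in\mathcal F$ and adapted defining functions $\varphi_i$ for $C_i$, $i=1,\ldots,n$, such that $\varphi_i\le 0$ on $K$ and $K\cap C_i=\{0_X\}$ for every $i$, and, writing $V_i:=\{x\in X:\varphi_i(x)>\tfrac12\|x\|\}$, one has \[ \Pi_{S_X}(A)\subset\bigcup_{i=1}^n\{x\in X:\varphi_i(x)>1/2\},\qquad A\subset\bigcup_{i=1}^n V_i\subset\bigcup_{i=1}^n\operatorname{int}C_i. \]
   Context: $S_X$ is the unit sphere, $B(x,r)=\{y\in X:\|y-x\|\le r\}$, $\operatorname{cone}(A)=\{ta:t\ge0,\ a\in A\}$. A nonempty set $C\subset X$ is a cone if $tC\subset C$ for every $t\ge 0$; all cones are assumed proper, i.e. $\{0_X\}\subsetneq C\subsetneq X$ (not necessarily convex). A family $\mathcal F$ of closed cones in $X$ is directionally fine if for every $u\in S_X$ and $\varepsilon\in(0,1)$ there exists $C\in\mathcal F$ with $u\in\operatorname{int}C\subset C\subset\operatorname{cone}B(u,\varepsilon)$. For $A\subset X\setminus\{0_X\}$, $\Pi_{S_X}(A):=\{a/\|a\|:a\in A\}$; $A$ is directionally compact if $\Pi_{S_X}(A)$ is norm compact. A mapping is positively homogeneous if $\varphi(tx)=t\varphi(x)$ for all $t\ge0$, $x\in X$. For a closed cone $C$, an adapted defining function for $C$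 (at some direction $u\in S_X\cap\operatorname{int}C$) is a continuous positively homogeneous $\varphi:X\to\mathbb R$ with $C=\{\varphi\ge0\}$, $\varphi(u)=1$, and $\varphi(x)\le\|x\|$ for every $x\in X$. *)

theory Defs
  imports "HOL-Analysis.Analysis"
begin

text \<open>The library predicate \<^const>\<open>cone\<close> also holds of the empty set, of \<open>{0}\<close> and of the
  whole space; these are excluded here.\<close>
definition proper_cone :: "'a::real_normed_vector set \<Rightarrow> bool" where
  "proper_cone C \<longleftrightarrow> cone C \<and> {0} \<subset> C \<and> C \<subset> UNIV"

definition cone_gen :: "'a::real_normed_vector set \<Rightarrow> 'a set" where
  "cone_gen A = {t *\<^sub>R a | t a. 0 \<le> t \<and> a \<in> A}"

definition directionally_fine :: "'a::real_normed_vector set set \<Rightarrow> bool" where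
  "directionally_fine F \<longleftrightarrow>
     (\<forall>C\<in>F. closed C \<and> proper_cone C) \<and>
     (\<forall>u\<in>sphere 0 1. \<forall>\<epsilon>::real. 0 < \<epsilon> \<and> \<epsilon> < 1 \<longrightarrow>
        (\<exists>C\<in>F. u \<in> interior C \<and> interior C \<subseteq> C \<and> C \<subseteq> cone_gen (cball u \<epsilon>)))"

definition sphere_proj :: "'a::real_normed_vector set \<Rightarrow> 'a set" where
  "sphere_proj A = {a /\<^sub>R norm a | a. a \<in> A}"

definition directionally_compact :: "'a::real_normed_vector set \<Rightarrow> bool" where
  "directionally_compact A \<longleftrightarrow> A \<subseteq> UNIV - {0} \<and> compact (sphere_proj A)"

definition positively_homogeneous :: "('a::real_normed_vector \<Rightarrow> real) \<Rightarrow> bool" where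
  "positively_homogeneous \<phi> \<longleftrightarrow> (\<forall>t\<ge>0. \<forall>x. \<phi> (t *\<^sub>R x) = t * \<phi> x)"

definition adapted_defining_at ::
    "'a::real_normed_vector set \<Rightarrow> 'a \<Rightarrow> ('a \<Rightarrow> real) \<Rightarrow> bool" where
  "adapted_defining_at C u \<phi> \<longleftrightarrow>
     closed C \<and> proper_cone C \<and> u \<in> sphere 0 1 \<inter> interior C \<and>
     continuous_on UNIV \<phi> \<and> positively_homogeneous \<phi> \<and>
     C = {x. 0 \<le> \<phi> x} \<and> \<phi> u = 1 \<and> (\<forall>x. \<phi> x \<le> norm x)"

definition adapted_defining :: "'a::real_normed_vector set \<Rightarrow> ('a \<Rightarrow> real) \<Rightarrow> bool" where
  "adapted_defining C \<phi> \<longleftrightarrow> (\<exists>u. adapted_defining_at C u \<phi>)"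

end

theory Submission
  imports Defs
begin

text \<open>For a closed proper cone \<open>C\<close>, the signed distance
  \<open>dist(x, X - C) - dist(x, C)\<close> is continuous and positively homogeneous, and nonnegative exactly
  on \<open>C\<close>; scaling it to be \<open>1\<close> at \<open>u\<close> and truncating it by the norm gives an adapted defining
  function at any unit vector \<open>u\<close> in the interior of \<open>C\<close>. For \<open>u \<notin> K\<close> a small ball around \<open>u\<close> misses
  \<open>K\<close>, so a fine enough cone around \<open>u\<close> meets \<open>K\<close> only at the origin, and compactness of the set of
  directions of \<open>A\<close> leaves finitely many such cones.\<close>

text \<open>Each competitor \<open>a\<close> for \<open>x\<close> yields the competitor
  \<open>t *\<^sub>R a\<close> for \<open>t *\<^sub>R x\<close>. The reverse inequality comes from
  the same bound used with \<open>inverse t\<close>.\<close>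

lemma infdist_scaleR_le:
  fixes S :: "'a::real_normed_vector set"
  assumes S: "\<And>t a. 0 < t \<Longrightarrow> a \<in> S \<Longrightarrow> t *\<^sub>R a \<in> S" and "0 < t"
  shows "infdist (t *\<^sub>R x) S \<le> t * infdist x S"
proof (cases "S = {}")
  case True
  then show ?thesis by (simp add: infdist_def)
next
  case False
  have "infdist (t *\<^sub>R x) S / t \<le> dist x a" if "a \<in> S" for a
  proof -
    have "infdist (t *\<^sub>R x) S \<le> dist (t *\<^sub>R x) (t *\<^sub>R a)"
      using S[OF \<open>0 < t\<close> that] by (rule infdist_le)
    also have "\<dots> = t * dist x a"
      using \<open>0 < t\<close> by (simp add: dist_norm flip: scaleR_diff_right)
    finally show ?thesis
      using \<open>0 < t\<close> by (simp add: field_simps)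
  qed
  then have "infdist (t *\<^sub>R x) S / t \<le> infdist x S"
    unfolding infdist_notempty[OF False] by (intro cINF_greatest False)
  then show ?thesis
    using \<open>0 < t\<close> by (simp add: field_simps)
qed

text \<open>Only scalars \<open>0 < t\<close> enter the assumption, so that the lemma also applies
  to the complement of a cone, which misses the origin.\<close>

lemma positively_homogeneous_infdist:
  fixes S :: "'a::real_normed_vector set"
  assumes S: "\<And>t a. 0 < t \<Longrightarrow> a \<in> S \<Longrightarrow> t *\<^sub>R a \<in> S"
  shows "positively_homogeneous (\<lambda>x. infdist x S)"
proof -
  have pos: "infdist (t *\<^sub>R x) S = t * infdist x S" if "0 < t" for t x
  proof (rule antisym)
    show "infdist (t *\<^sub>R x) S \<le> t * infdist x S"
      using S that by (rule infdist_scaleR_le)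
    have "infdist (inverse t *\<^sub>R t *\<^sub>R x) S \<le> inverse t * infdist (t *\<^sub>R x) S"
      by (rule infdist_scaleR_le) (use S that in auto)
    then show "t * infdist x S \<le> infdist (t *\<^sub>R x) S"
      using that by (simp add: field_simps)
  qed
  \<comment> \<open>The scalar \<open>t = 0\<close> is settled by doubling the origin: the distance
    equals twice itself, whether or not \<open>0\<close> lies in \<open>S\<close>.\<close>
  moreover have "infdist 0 S = 0"
    using pos[of 2 0] by simp
  ultimately show ?thesis
    unfolding positively_homogeneous_def by (metis less_eq_real_def mult_zero_left scaleR_zero_left)
qed

lemma adapted_defining_at_exists:
  fixes C :: "'a::real_normed_vector set"
  assumes "closed C" "proper_cone C" "u \<in> sphere 0 1" "u \<in> interior C"
  shows "\<exists>\<phi>. adapted_defining_at C u \<phi>"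
proof -
  have coneC: "t *\<^sub>R a \<in> C" if "0 < t" "a \<in> C" for t a
    using assms(2) that by (auto simp: proper_cone_def cone_def)
  have coneCc: "t *\<^sub>R a \<in> - C" if "0 < t" "a \<in> - C" for t a
    using coneC[of "inverse t" "t *\<^sub>R a"] that by auto
  \<comment> \<open>\<open>infdist\<close> to the empty set is \<open>0\<close> by convention, so a
    positive distance to \<open>C\<close> or to \<open>- C\<close> requires that set to be
    nonempty.\<close>
  have ne: "C \<noteq> {}" "- C \<noteq> {}"
    using assms(2) by (auto simp: proper_cone_def)
  define g where "g x = infdist x (- C) - infdist x C" for x
  have g_hom: "g (t *\<^sub>R x) = t * g x" if "0 \<le> t" for t x
    using that positively_homogeneous_infdist[OF coneC] positively_homogeneous_infdist[OF coneCc]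
    by (simp add: g_def positively_homogeneous_def right_diff_distrib)
  have g_cont: "continuous_on UNIV g"
    unfolding g_def by (intro continuous_intros)
  have g_neg: "g x < 0" if "x \<notin> C" for x
    using that infdist_pos_not_in_closed[OF \<open>closed C\<close> ne(1) that] by (simp add: g_def)
  have g_nonneg: "0 \<le> g x" if "x \<in> C" for x
    using that by (simp add: g_def infdist_nonneg)
  have "infdist u (- C) \<noteq> 0"
    using assms(4) ne(2) by (simp add: closure_complement flip: in_closure_iff_infdist_zero)
  then have g_u: "0 < g u"
    using assms(4) interior_subset[of C] infdist_nonneg[of u "- C"] by (auto simp: g_def)
  \<comment> \<open>Truncation preserves the set where the function is nonnegative, because the norm
    is nonnegative, and the value at \<open>u\<close>, where both terms equal 1.\<close>
  define \<phi> where "\<phi> x = min (g x / g u) (norm x)" for x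
  have "positively_homogeneous \<phi>"
    by (auto simp: positively_homogeneous_def \<phi>_def g_hom min_mult_distrib_left)
  moreover have "continuous_on UNIV \<phi>"
    unfolding \<phi>_def using g_u by (intro continuous_intros g_cont) auto
  moreover have "C = {x. 0 \<le> \<phi> x}"
    using g_neg g_nonneg g_u by (force simp: \<phi>_def zero_le_divide_iff)
  moreover have "\<phi> u = 1"
    using g_u assms(3) by (simp add: \<phi>_def)
  moreover have "\<phi> x \<le> norm x" for x
    by (simp add: \<phi>_def)
  ultimately have "adapted_defining_at C u \<phi>"
    using assms by (simp add: adapted_defining_at_def)
  then show ?thesis by blast
qed

text \<open>The bound forces \<open>\<phi> x\<close> to be positive, and positivity of the
  continuous \<open>\<phi>\<close> defines an open subset of \<open>C\<close>.\<close>

lemma adapted_defining_gt_half_norm_subset_interior: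
  assumes "adapted_defining C \<phi>"
  shows "{x. \<phi> x > 1/2 * norm x} \<subseteq> interior C"
proof -
  have cont: "continuous_on UNIV \<phi>" and C: "C = {x. 0 \<le> \<phi> x}"
    using assms by (auto simp: adapted_defining_def adapted_defining_at_def)
  have "open {x. 0 < \<phi> x}"
    by (intro open_Collect_less continuous_intros cont)
  then have "{x. 0 < \<phi> x} \<subseteq> interior C"
    using C by (intro interior_maximal) auto
  moreover have "0 < \<phi> x" if "\<phi> x > 1/2 * norm x" for x
    using that norm_ge_zero[of x] by linarith
  ultimately show ?thesis by blast
qed

lemma directionally_fine_separating_cone:
  fixes F :: "'a::real_normed_vector set set"
  assumes "directionally_fine F" "closed K" "proper_cone K" "u \<in> sphere 0 1" "u \<notin> K"
  shows "\<exists>C\<in>F. u \<in> interior C \<and> K \<inter> C = {0}"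
proof -
  obtain e where e: "0 < e" "ball u e \<subseteq> - K"
    using \<open>closed K\<close> \<open>u \<notin> K\<close> by (meson ComplI openE open_Compl)
  \<comment> \<open>Fineness asks for a radius below 1; \<open>d < e\<close> puts the closed ball of
    radius \<open>d\<close> inside the open ball that misses \<open>K\<close>.\<close>
  define d where "d = min (e / 2) (1 / 2)"
  have d: "0 < d" "d < 1" "d < e"
    using e by (auto simp: d_def)
  obtain C where C: "C \<in> F" "u \<in> interior C" "C \<subseteq> cone_gen (cball u d)"
    using assms(1,4) d unfolding directionally_fine_def by blast
  have "x = 0" if xK: "x \<in> K" and xC: "x \<in> C" for x
  proof -
    obtain t a where ta: "x = t *\<^sub>R a" "0 \<le> t" "a \<in> cball u d"
      using C(3) xC by (auto simp: cone_gen_def)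
    have "a \<in> ball u e"
      using ta(3) d(3) by auto
    then have "a \<notin> K"
      using e(2) by auto
    \<comment> \<open>For \<open>t > 0\<close> this vector is \<open>a\<close>, a contradiction; for
      \<open>t = 0\<close> the inverse is \<open>0\<close> by convention and \<open>x = 0\<close>
      holds directly.\<close>
    moreover have "inverse t *\<^sub>R x \<in> K"
      using assms(3) xK ta(2) by (simp add: proper_cone_def cone_def)
    ultimately show "x = 0"
      using ta(1) by (cases "t = 0") auto
  qed
  moreover have "0 \<in> K" "0 \<in> C"
    using assms(1,3) C(1) by (auto simp: directionally_fine_def proper_cone_def)
  ultimately show ?thesis
    using C by blast
qed

theorem theorem3p5:
  fixes F :: "'a::real_normed_vector set set" and K A :: "'a set"
  assumes "directionally_fine F"
    and "closed K" and "proper_cone K"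
    and "A \<subseteq> UNIV - {0}" and "directionally_compact A"
    and "A \<inter> K = {}"
  shows "\<exists>(n::nat) (C :: nat \<Rightarrow> 'a set) (\<phi> :: nat \<Rightarrow> 'a \<Rightarrow> real).
    (\<forall>i\<in>{1..n}. C i \<in> F \<and> adapted_defining (C i) (\<phi> i) \<and>
        (\<forall>x\<in>K. \<phi> i x \<le> 0) \<and> K \<inter> C i = {0}) \<and>
    (let V = (\<lambda>i. {x. \<phi> i x > 1/2 * norm x}) in
      sphere_proj A \<subseteq> (\<Union>i\<in>{1..n}. {x. \<phi> i x > 1/2}) \<and>
      A \<subseteq> (\<Union>i\<in>{1..n}. V i) \<and>
      (\<Union>i\<in>{1..n}. V i) \<subseteq> (\<Union>i\<in>{1..n}. interior (C i)))"
proof -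
  have dir: "u \<in> sphere 0 1 \<and> u \<notin> K" if u: "u \<in> sphere_proj A" for u
  proof -
    obtain a where a: "a \<in> A" "u = a /\<^sub>R norm a"
      using u by (auto simp: sphere_proj_def)
    have "a \<noteq> 0" "a \<notin> K"
      using a(1) assms(4,6) by auto
    moreover have "norm a *\<^sub>R u \<in> K" if "u \<in> K"
      using that assms(3) by (simp add: proper_cone_def cone_def)
    ultimately show ?thesis
      using a(2) by auto
  qed
  have "\<exists>C \<phi>. C \<in> F \<and> K \<inter> C = {0} \<and> adapted_defining_at C u \<phi>"
    if u: "u \<in> sphere_proj A" for u
  proof -
    obtain C where C: "C \<in> F" "u \<in> interior C" "K \<inter> C = {0}"
      using directionally_fine_separating_cone[OF assms(1-3)] dir[OF u] by blast
    then have "closed C" "proper_cone C"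
      using assms(1) by (auto simp: directionally_fine_def)
    then show ?thesis
      using adapted_defining_at_exists dir[OF u] C by blast
  qed
  then obtain C \<phi> where C: "C u \<in> F" "K \<inter> C u = {0}" "adapted_defining_at (C u) u (\<phi> u)"
    if "u \<in> sphere_proj A" for u
    by metis
  have "compact (sphere_proj A)"
    using assms(5) by (simp add: directionally_compact_def)
  moreover have "open {x. \<phi> u x > 1/2}" if "u \<in> sphere_proj A" for u
    using C(3)[OF that] by (intro open_Collect_less) (auto simp: adapted_defining_at_def)
  \<comment> \<open>Each direction lies in its own set, since \<open>\<phi> u u = 1\<close>.\<close>
  moreover have "sphere_proj A \<subseteq> (\<Union>u\<in>sphere_proj A. {x. \<phi> u x > 1/2})"
    using C(3) by (force simp: adapted_defining_at_def)
  ultimately obtain D where D: "D \<subseteq> sphere_proj A" "finite D"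
      "sphere_proj A \<subseteq> (\<Union>u\<in>D. {x. \<phi> u x > 1/2})"
    by (rule compactE_image)
  \<comment> \<open>The finite subcover is renumbered from 1; an empty \<open>A\<close> gives no
    cones at all.\<close>
  obtain h where h: "bij_betw h {1..card D} D"
    using ex_bij_betw_nat_finite_1[OF D(2)] by blast
  then have hD: "h ` {1..card D} = D"
    by (simp add: bij_betw_def)
  have adapted: "adapted_defining (C (h i)) (\<phi> (h i))"
    and in_F: "C (h i) \<in> F" and meet: "K \<inter> C (h i) = {0}" if "i \<in> {1..card D}" for i
  proof -
    have "h i \<in> sphere_proj A"
      using that hD D(1) by blast
    then show "adapted_defining (C (h i)) (\<phi> (h i))" "C (h i) \<in> F" "K \<inter> C (h i) = {0}"
      using C unfolding adapted_defining_def by blast+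
  qed
  \<comment> \<open>A positive value would put \<open>x\<close> in
    \<open>K \<inter> C (h i)\<close>, hence at the origin, where the norm bound allows no positive
    value.\<close>
  have nonpos: "\<phi> (h i) x \<le> 0" if i: "i \<in> {1..card D}" and x: "x \<in> K" for i x
  proof -
    have eq: "C (h i) = {x. 0 \<le> \<phi> (h i) x}" and bound: "\<phi> (h i) x \<le> norm x"
      using adapted[OF i] by (auto simp: adapted_defining_def adapted_defining_at_def)
    show ?thesis
    proof (rule ccontr)
      assume "\<not> \<phi> (h i) x \<le> 0"
      then have "x \<in> K \<inter> C (h i)"
        using eq x by auto
      then have "x = 0"
        using meet[OF i] by blast
      then show False
        using bound \<open>\<not> \<phi> (h i) x \<le> 0\<close> by simp
    qed
  qed
  have cover: "sphere_proj A \<subseteq> (\<Union>i\<in>{1..card D}. {x. \<phi> (h i) x > 1/2})"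
  proof
    fix u assume "u \<in> sphere_proj A"
    then obtain v where v: "v \<in> D" "\<phi> v u > 1/2"
      using D(3) by blast
    obtain i where "i \<in> {1..card D}" "v = h i"
      using v(1) by (rule imageE[of v h "{1..card D}", unfolded hD]) blast
    then show "u \<in> (\<Union>i\<in>{1..card D}. {x. \<phi> (h i) x > 1/2})"
      using v(2) by blast
  qed
  have cover_A: "A \<subseteq> (\<Union>i\<in>{1..card D}. {x. \<phi> (h i) x > 1/2 * norm x})"
  proof
    fix a assume a: "a \<in> A"
    then have "norm a > 0"
      using assms(4) by auto
    obtain i where i: "i \<in> {1..card D}" "\<phi> (h i) (a /\<^sub>R norm a) > 1/2"
      using cover a by (fastforce simp: sphere_proj_def)
    \<comment> \<open>Homogeneity turns the threshold \<open>1/2\<close> on the unit sphere into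
      \<open>1/2 * norm a\<close> at \<open>a\<close> itself.\<close>
    have "\<phi> (h i) (a /\<^sub>R norm a) = \<phi> (h i) a / norm a"
      using adapted[OF i(1)]
      by (auto simp: adapted_defining_def adapted_defining_at_def positively_homogeneous_def
          divide_inverse)
    then have "\<phi> (h i) a > 1/2 * norm a"
      using i(2) \<open>norm a > 0\<close> by (simp add: field_simps)
    then show "a \<in> (\<Union>i\<in>{1..card D}. {x. \<phi> (h i) x > 1/2 * norm x})"
      using i(1) by blast
  qed
  have inside: "(\<Union>i\<in>{1..card D}. {x. \<phi> (h i) x > 1/2 * norm x})
      \<subseteq> (\<Union>i\<in>{1..card D}. interior (C (h i)))"
    by (intro UN_mono order_refl adapted_defining_gt_half_norm_subset_interior adapted)
  show ?thesis
    unfolding Let_def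
    by (rule exI[of _ "card D"], rule exI[of _ "\<lambda>i. C (h i)"], rule exI[of _ "\<lambda>i. \<phi> (h i)"])
      (intro conjI ballI adapted in_F meet nonpos cover cover_A inside)
qed

end
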